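(* In the setting fixed in the context (regularized 2-1 junction problem with fixed $T$, $n$, $v_j$, $p$, $\epsilon$, $H_\epsilon$, $\eta_0$, $\Phi$, $A^j_{hk}$), let $\{\{\boldsymbol{\varphi}^r\}_{r=1}^{3},\,\{\bar{\mathbf f}^r\}_{r=1}^{2},\,\{\bar\Phi^r_f\}_{r=1}^{3}\}$ and $\{\{\boldsymbol{\phi}^r\}_{r=1}^{3},\,\{\bar{\mathbf g}^r\}_{r=1}^{2},\,\{\bar\Phi^r_g\}_{r=1}^{3}\}$ be two sets of initial and boundary data for the 2-1 junction and let $\mathbf F_1,\mathbf G_1\in\mathcal B^3$ be two corresponding mild kinetic solutions across the (regularized) 2-1 junction. Then there exists $\mathcal C>0$ such that $$\Vert \mathbf G_1-\mathbf F_1\Vert_\infty\leq \mathcal C\left[\sum_{r=1}^{3}\Vert\boldsymbol{\phi}^r-\boldsymbol{\varphi}^r\Vert_1+\int_0^T\left(\sum_{r=1}^{3}\left|\bar\Phi^r_g(t)-\bar\Phi^r_f(t)\right|+\sum_{r=1}^{2}\Vert\bar{\mathbf g}^r(t)-\bar{\mathbf f}^r(t)\Vert_1\right)dt\right].$$ In particular, there is at most one mild kinetic solution across the 2-1 junction corresponding to a given set of initial and boundary data.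
   Context: Fixed quantities: $T>0$; an integer $n\ge 2$; speeds $0=v_1<v_2<\dots<v_n=1$; a flux threshold $p\in[0,1]$ with $p\le v_2$; $\eta_0>0$; $\epsilon>0$ and a Lipschitz continuous function $H_\epsilon:\mathbb R\to\mathbb R$ with $H_\epsilon(x)=0$ for $x\le0$, $H_\epsilon(x)=1$ for $x\ge\epsilon$, and $0\le H_\epsilon(x)\le1$ for $0<x<\epsilon$. Put $\delta^c_{1j}=0$ if $j=1$ and $\delta^c_{1j}=1$ if $j\ge2$. Function spaces. $X_T=C([0,T];\mathbb R^n)$ and $$\mathcal B=\Big\{\mathbf u\in X_T:\ 0\le u_j(t)\le1,\ \sum_{j=1}^n u_j(t)\le 1\ \ \forall j=1,\dots,n,\ \forall t\in[0,T]\Big\}.$$ A constant vector is regarded as a constant function when membership in $\mathcal B$ is asserted. For $\mathbf U=(\mathbf u^1,\mathbf u^2,\mathbf u^3)\in\mathcal B^3$, $\Vert\mathbf U\Vert_\infty=\sup_{t\in[0,T]}\sum_{r=1}^3\sum_{j=1}^n|u^r_j(t)|$; $\Vert\cdot\Vert_1$ is the 1-norm on $\mathbb R^n$. Table of games. For $h,k,j\in\{1,\dots,n\}$ and $\rho\in[0,1]$, $A^j_{hk}[\rho]\geq 0$ are given probabilities with $\sum_{j=1}^nA^j_{hk}[\rho]=1$ for all $h,k,\rho$, and each $\rho\mapsto A^j_{hk}[\rho]$ is Lipschitz continuous on $[0,1]$. For $\mathbf f=(f_1,\dots,f_n)$ with $\rho=\sum_{j}f_j$, $$G_j[\mathbf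 f,\mathbf f]=\eta_0\,\rho\sum_{h,k=1}^nA^j_{hk}[\rho]f_hf_k,\qquad L[\mathbf f]=\eta_0\,\rho^2 .$$ Flux limiter. $\Phi:[0,1]^2\to[0,1]$ satisfies: (i) $0\le\Phi(u,v)\le1$; (ii) $\Phi(u,v)u\le1-v$ whenever $u+v>1$; (iii) there is $\mathrm{Lip}(\Phi)>0$ with $|\Phi(u_2,v_2)-\Phi(u_1,v_1)|\le\mathrm{Lip}(\Phi)(|u_2-u_1|+|v_2-v_1|)$ for all $(u_1,v_1),(u_2,v_2)\in[0,1]^2$. Data. A set of initial and boundary data is $\{\{\boldsymbol\varphi^r\}_{r=1}^3,\{\bar{\mathbf f}^r\}_{r=1}^2,\{\bar\Phi^r\}_{r=1}^3\}$, where $\boldsymbol\varphi^r=(\varphi^r_1,\dots,\varphi^r_n)\in\mathcal B$ are constant vectors, $\bar{\mathbf f}^r=(\bar f^r_1,\dots,\bar f^r_n)\in\mathcal B$ for $r=1,2$, $\bar\Phi^3:[0,T]\to[0,1]$ is measurable, and, for $r=1,2$, $\bar\Phi^r(t)=\Phi(\bar\rho^r(t),\rho^r_1(t))$ with $\bar\rho^r=\sum_{j}\bar f^r_j$ and $\rho^r_1=\sum_jf^r_{1j}$ the density on road $r$ of the solution under consideration. (The subscripts $f$, $g$ on $\bar\Phi^r$ indicate which of the two sets of data / solutions they refer to.) Mild solution. A function $\mathbf F_1=(\mathbf f^1_1,\mathbf f^2_1,\mathbf f^3_1):[0,T]\to\mathbb R^n\times\mathbb R^n\times\mathbb R^n$,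 $\mathbf f^r_1=(f^r_{1j})_{j=1}^n$, is a mild kinetic solution across the (regularized) 2-1 junction if $\mathbf F_1\in\mathcal B^3$ and for all $t\in[0,T]$, $j=1,\dots,n$, $$f^1_{1j}(t)=\varphi^1_j+\int_0^t\Big\{v_j\big(\bar\Phi^1\bar f^1_j-\Phi^3_{0,1}f^1_{1j}\big)+G_j[\mathbf f^1_1,\mathbf f^1_1]-f^1_{1j}L[\mathbf f^1_1]\Big\}ds,$$ $$f^2_{1j}(t)=\varphi^2_j+\int_0^t\Big\{v_j\big(\bar\Phi^2\bar f^2_j-H_\epsilon(p-(q^1_1+q^2_1))\Phi^3_{0,1}f^2_{1j}\big)+G_j[\mathbf f^2_1,\mathbf f^2_1]-f^2_{1j}L[\mathbf f^2_1]\Big\}ds,$$ $$f^3_{1j}(t)=\varphi^3_j+\int_0^t\Big\{v_j\big(\Phi^3_{0,1}\,(f^1_{1j}+H_\epsilon(p-(q^1_1+q^2_1))f^2_{1j})\,\delta^c_{1j}-\bar\Phi^3f^3_{1j}\big)+G_j[\mathbf f^3_1,\mathbf f^3_1]-f^3_{1j}L[\mathbf f^3_1]\Big\}ds,$$ all functions in the integrands being evaluated at time $s$, where $q^r_1=\sum_{j=1}^nv_jf^r_{1j}$ for $r=1,2$, $\Phi^3_{0,1}=\Phi(\rho^3_0,\rho^3_1)$, $\rho^3_1=\sum_{j=1}^nf^3_{1j}$ and $\rho^3_0=\sum_{j=2}^n\big[f^1_{1j}+H_\epsilon(p-(q^1_1+q^2_1))f^2_{1j}\big]$ (which lies in $[0,1]$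 because $p\le v_2$). *)

theory Defs
  imports "HOL-Analysis.Analysis"
begin

text \<open>
  Vectors of \<open>\<real>\<^sup>n\<close> are functions on the natural numbers of which only the values at \<open>1, \<dots>, n\<close>
  are relevant; a time-dependent vector \<open>u\<close> is applied as \<open>u t j\<close>, and a family of these
  indexed by the roads \<open>r = 1, 2, 3\<close> as \<open>F r t j\<close>. The entry $A^j_{hk}[\rho]$ of the table of games
  is \<open>A j h k \<rho>\<close>.
\<close>

definition X_space :: "real \<Rightarrow> nat \<Rightarrow> (real \<Rightarrow> nat \<Rightarrow> real) set" where
  "X_space T n = {u. \<forall>j\<in>{1..n}. continuous_on {0..T} (\<lambda>t. u t j)}"

definition B_space :: "real \<Rightarrow> nat \<Rightarrow> (real \<Rightarrow> nat \<Rightarrow> real) set" where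
  "B_space T n = {u \<in> X_space T n. \<forall>t\<in>{0..T}.
     (\<forall>j\<in>{1..n}. 0 \<le> u t j \<and> u t j \<le> 1) \<and> (\<Sum>j=1..n. u t j) \<le> 1}"

definition norm1 :: "nat \<Rightarrow> (nat \<Rightarrow> real) \<Rightarrow> real" where
  "norm1 n x = (\<Sum>j=1..n. \<bar>x j\<bar>)"

definition norm_sup :: "real \<Rightarrow> nat \<Rightarrow> (nat \<Rightarrow> real \<Rightarrow> nat \<Rightarrow> real) \<Rightarrow> real" where
  "norm_sup T n U = (SUP t\<in>{0..T}. \<Sum>r=1..3. \<Sum>j=1..n. \<bar>U r t j\<bar>)"

definition car_density :: "nat \<Rightarrow> (nat \<Rightarrow> real) \<Rightarrow> real" where
  "car_density n f = (\<Sum>j=1..n. f j)"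

definition car_flux :: "nat \<Rightarrow> (nat \<Rightarrow> real) \<Rightarrow> (nat \<Rightarrow> real) \<Rightarrow> real" where
  "car_flux n v f = (\<Sum>j=1..n. v j * f j)"

definition gain :: "nat \<Rightarrow> real \<Rightarrow> (nat \<Rightarrow> nat \<Rightarrow> nat \<Rightarrow> real \<Rightarrow> real) \<Rightarrow> (nat \<Rightarrow> real) \<Rightarrow> nat \<Rightarrow> real" where
  "gain n \<eta> A f j =
     \<eta> * car_density n f * (\<Sum>h=1..n. \<Sum>k=1..n. A j h k (car_density n f) * f h * f k)"

definition loss :: "nat \<Rightarrow> real \<Rightarrow> (nat \<Rightarrow> real) \<Rightarrow> real" where
  "loss n \<eta> f = \<eta> * (car_density n f)\<^sup>2"

definition table_of_games :: "nat \<Rightarrow> (nat \<Rightarrow> nat \<Rightarrow> nat \<Rightarrow> real \<Rightarrow> real) \<Rightarrow> bool" where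
  "table_of_games n A \<longleftrightarrow>
     (\<forall>h\<in>{1..n}. \<forall>k\<in>{1..n}. \<forall>\<rho>\<in>{0..1}.
        (\<forall>j\<in>{1..n}. 0 \<le> A j h k \<rho>) \<and> (\<Sum>j=1..n. A j h k \<rho>) = 1) \<and>
     (\<forall>h\<in>{1..n}. \<forall>k\<in>{1..n}. \<forall>j\<in>{1..n}. \<exists>l. l-lipschitz_on {0..1} (A j h k))"

definition flux_limiter :: "(real \<Rightarrow> real \<Rightarrow> real) \<Rightarrow> bool" where
  "flux_limiter \<Phi> \<longleftrightarrow>
     (\<forall>x\<in>{0..1}. \<forall>y\<in>{0..1}. 0 \<le> \<Phi> x y \<and> \<Phi> x y \<le> 1) \<and>
     (\<forall>x\<in>{0..1}. \<forall>y\<in>{0..1}. x + y > 1 \<longrightarrow> \<Phi> x y * x \<le> 1 - y) \<and>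
     (\<exists>l>0. \<forall>x1\<in>{0..1}. \<forall>y1\<in>{0..1}. \<forall>x2\<in>{0..1}. \<forall>y2\<in>{0..1}.
        \<bar>\<Phi> x2 y2 - \<Phi> x1 y1\<bar> \<le> l * (\<bar>x2 - x1\<bar> + \<bar>y2 - y1\<bar>))"

definition regularized_step :: "real \<Rightarrow> (real \<Rightarrow> real) \<Rightarrow> bool" where
  "regularized_step \<epsilon> H \<longleftrightarrow>
     (\<exists>l. l-lipschitz_on UNIV H) \<and>
     (\<forall>x\<le>0. H x = 0) \<and> (\<forall>x\<ge>\<epsilon>. H x = 1) \<and> (\<forall>x. 0 < x \<and> x < \<epsilon> \<longrightarrow> 0 \<le> H x \<and> H x \<le> 1)"

text \<open>
  The data that can be prescribed freely are \<open>\<phi> r j\<close> (\<open>r = 1, 2, 3\<close>), \<open>fb r t j\<close> (\<open>r = 1, 2\<close>) and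
  the outflow limiter \<open>\<Phi>3 t\<close> of road 3. The remaining boundary limiters, those of roads 1 and 2,
  are functions of the data and of the solution \<open>F\<close>; \<open>bdry_limiter\<close> collects all three.
\<close>

definition junction_data ::
    "real \<Rightarrow> nat \<Rightarrow> (nat \<Rightarrow> nat \<Rightarrow> real) \<Rightarrow> (nat \<Rightarrow> real \<Rightarrow> nat \<Rightarrow> real) \<Rightarrow> (real \<Rightarrow> real) \<Rightarrow> bool" where
  "junction_data T n \<phi> fb \<Phi>3 \<longleftrightarrow>
     (\<forall>r\<in>{1..3}. (\<lambda>t. \<phi> r) \<in> B_space T n) \<and>
     (\<forall>r\<in>{1..2}. fb r \<in> B_space T n) \<and>
     \<Phi>3 \<in> borel_measurable (lebesgue_on {0..T}) \<and> (\<forall>t\<in>{0..T}. 0 \<le> \<Phi>3 t \<and> \<Phi>3 t \<le> 1)"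

definition bdry_limiter ::
    "nat \<Rightarrow> (real \<Rightarrow> real \<Rightarrow> real) \<Rightarrow> (nat \<Rightarrow> real \<Rightarrow> nat \<Rightarrow> real) \<Rightarrow> (real \<Rightarrow> real) \<Rightarrow>
     (nat \<Rightarrow> real \<Rightarrow> nat \<Rightarrow> real) \<Rightarrow> nat \<Rightarrow> real \<Rightarrow> real" where
  "bdry_limiter n \<Phi> fb \<Phi>3 F r t =
     (if r = 3 then \<Phi>3 t else \<Phi> (car_density n (fb r t)) (car_density n (F r t)))"

text \<open>The factor $H_\epsilon(p - (q^1_1 + q^2_1))$ at time \<open>t\<close>.\<close>

definition merge_factor ::
    "nat \<Rightarrow> (nat \<Rightarrow> real) \<Rightarrow> real \<Rightarrow> (real \<Rightarrow> real) \<Rightarrow> (nat \<Rightarrow> real \<Rightarrow> nat \<Rightarrow> real) \<Rightarrow> real \<Rightarrow> real" where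
  "merge_factor n v p H F t = H (p - (car_flux n v (F 1 t) + car_flux n v (F 2 t)))"

text \<open>The limiter $\Phi^3_{0,1} = \Phi(\rho^3_0, \rho^3_1)$ at time \<open>t\<close>.\<close>

definition junction_limiter ::
    "nat \<Rightarrow> (nat \<Rightarrow> real) \<Rightarrow> real \<Rightarrow> (real \<Rightarrow> real) \<Rightarrow> (real \<Rightarrow> real \<Rightarrow> real) \<Rightarrow>
     (nat \<Rightarrow> real \<Rightarrow> nat \<Rightarrow> real) \<Rightarrow> real \<Rightarrow> real" where
  "junction_limiter n v p H \<Phi> F t =
     \<Phi> (\<Sum>j=2..n. F 1 t j + merge_factor n v p H F t * F 2 t j) (car_density n (F 3 t))"

definition mild_solution ::
    "real \<Rightarrow> nat \<Rightarrow> (nat \<Rightarrow> real) \<Rightarrow> real \<Rightarrow> (real \<Rightarrow> real) \<Rightarrow> real \<Rightarrow>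
     (nat \<Rightarrow> nat \<Rightarrow> nat \<Rightarrow> real \<Rightarrow> real) \<Rightarrow> (real \<Rightarrow> real \<Rightarrow> real) \<Rightarrow>
     (nat \<Rightarrow> nat \<Rightarrow> real) \<Rightarrow> (nat \<Rightarrow> real \<Rightarrow> nat \<Rightarrow> real) \<Rightarrow> (real \<Rightarrow> real) \<Rightarrow>
     (nat \<Rightarrow> real \<Rightarrow> nat \<Rightarrow> real) \<Rightarrow> bool" where
  "mild_solution T n v p H \<eta> A \<Phi> \<phi> fb \<Phi>3 F \<longleftrightarrow>
     (\<forall>r\<in>{1..3}. F r \<in> B_space T n) \<and>
     (\<forall>t\<in>{0..T}. \<forall>j\<in>{1..n}.
        F 1 t j = \<phi> 1 j + (LINT s|lebesgue_on {0..t}.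
          v j * (bdry_limiter n \<Phi> fb \<Phi>3 F 1 s * fb 1 s j - junction_limiter n v p H \<Phi> F s * F 1 s j)
          + gain n \<eta> A (F 1 s) j - F 1 s j * loss n \<eta> (F 1 s)) \<and>
        F 2 t j = \<phi> 2 j + (LINT s|lebesgue_on {0..t}.
          v j * (bdry_limiter n \<Phi> fb \<Phi>3 F 2 s * fb 2 s j
                 - merge_factor n v p H F s * junction_limiter n v p H \<Phi> F s * F 2 s j)
          + gain n \<eta> A (F 2 s) j - F 2 s j * loss n \<eta> (F 2 s)) \<and>
        F 3 t j = \<phi> 3 j + (LINT s|lebesgue_on {0..t}.
          v j * (junction_limiter n v p H \<Phi> F s * (F 1 s j + merge_factor n v p H F s * F 2 s j)
                   * (if j = 1 then 0 else 1)
                 - bdry_limiter n \<Phi> fb \<Phi>3 F 3 s * F 3 s j)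
          + gain n \<eta> A (F 3 s) j - F 3 s j * loss n \<eta> (F 3 s)))"

end

theory Submission
  imports Defs
begin

text \<open>
  The source terms that involve only the traffic state are sums and products of bounded Lipschitz
  functions of that state, once \<open>p \<le> v 2\<close> guarantees that the inflow density \<open>\<rho>\<^sup>3\<^sub>0\<close> stays in the
  interval where the flux limiter is Lipschitz. The remaining source terms are linear in the
  boundary data. Hence the 1-norm distance of two mild solutions is bounded by the distance of
  the initial data plus the time integral of the gap of the boundary data and of a multiple of
  the distance itself, and Gronwall's inequality applies. For uniqueness, the gap
  between the boundary limiters is itself Lipschitz in the solutions and is absorbed into the
  Gronwall term.
\<close>

section \<open>Gronwall's inequality and elementary estimates\<close>

text \<open>The integrating factor turns the integral inequality into monotonicity of a single
  function; comparing its values at \<open>0\<close> and \<open>t\<close> gives the bound. The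
  constant \<open>a\<close> may have any sign; the case \<open>a = 0\<close> yields
  uniqueness.\<close>

lemma gronwall:
  fixes u :: "real \<Rightarrow> real"
  assumes u: "continuous_on {0..T} u" and "0 \<le> K"
    and le: "\<And>t. t \<in> {0..T} \<Longrightarrow> u t \<le> a + K * integral {0..t} u"
    and t: "t \<in> {0..T}"
  shows "u t \<le> a * exp (K * t)"
proof -
  \<comment> \<open>\<open>w\<close> is the right-hand side of the hypothesis, damped by
    \<open>exp (- K * s)\<close>. Its derivative is a nonnegative multiple of \<open>u s\<close>
    minus that right-hand side, hence nonpositive.\<close>
  define w where "w s = exp (- K * s) * (a + K * integral {0..s} u)" for s
  have D: "(w has_real_derivative exp (- K * s) * (K * (u s - (a + K * integral {0..s} u))))
        (at s within {0..T})" if "s \<in> {0..T}" for s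
    unfolding w_def
    by (auto intro!: derivative_eq_intros integral_has_real_derivative[OF u that]
        simp: algebra_simps)
  have "w t \<le> w 0"
  proof (rule DERIV_nonpos_imp_decreasing_open[of 0 t w])
    show "0 \<le> t" using t by simp
    have "continuous_on {0..T} w"
      using D by (meson DERIV_continuous continuous_on_eq_continuous_within)
    then show "continuous_on {0..t} w"
      by (rule continuous_on_subset) (use t in auto)
    \<comment> \<open>Since \<open>s\<close> lies strictly between \<open>0\<close> and
      \<open>t \<le> T\<close>, it is interior to \<open>{0..T}\<close>, so the one-sided derivative
      supplied by \<open>D\<close> is a genuine one.\<close>
    show "\<exists>y. (w has_real_derivative y) (at s) \<and> y \<le> 0" if "0 < s" "s < t" for s
    proof (intro exI conjI)
      show "(w has_real_derivative exp (- K * s) * (K * (u s - (a + K * integral {0..s} u)))) (at s)"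
        using D[of s] that t at_within_Icc_at[of 0 s T] by simp
      show "exp (- K * s) * (K * (u s - (a + K * integral {0..s} u))) \<le> 0"
        using le[of s] that t \<open>0 \<le> K\<close> by (simp add: mult_nonneg_nonpos)
    qed
  qed
  then have "exp (- K * t) * (a + K * integral {0..t} u) \<le> a"
    by (simp add: w_def)
  then have "a + K * integral {0..t} u \<le> a * exp (K * t)"
    by (simp add: exp_minus field_simps)
  with le[OF t] show ?thesis by linarith
qed

lemma sum_1_3: "(\<Sum>r=1..3. f r) = f 1 + f 2 + f (3::nat)"
  for f :: "nat \<Rightarrow> 'a::comm_monoid_add"
  by (simp add: numeral_3_eq_3 numeral_2_eq_2)

lemma sum_1_2: "(\<Sum>r=1..2. f r) = f 1 + f (2::nat)"
  for f :: "nat \<Rightarrow> 'a::comm_monoid_add"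
  by (simp add: numeral_2_eq_2)

lemma norm1_nonneg: "0 \<le> norm1 n x"
  by (simp add: norm1_def sum_nonneg)

lemma abs_le_norm1: "j \<in> {1..n} \<Longrightarrow> \<bar>x j\<bar> \<le> norm1 n x"
  unfolding norm1_def by (rule member_le_sum) auto

text \<open>The difference is telescoped through the mixed product \<open>c * b\<close>, so a bound
  on one factor of each product suffices. It serves products of a limiter with a density.\<close>

lemma abs_mult_diff_le:
  fixes a b c d :: real
  assumes "\<bar>b\<bar> \<le> 1" "\<bar>c\<bar> \<le> 1"
  shows "\<bar>a * b - c * d\<bar> \<le> \<bar>a - c\<bar> + \<bar>b - d\<bar>"
proof -
  have "a * b - c * d = (a - c) * b + c * (b - d)" by (simp add: algebra_simps)
  then have "\<bar>a * b - c * d\<bar> \<le> \<bar>a - c\<bar> * \<bar>b\<bar> + \<bar>c\<bar> * \<bar>b - d\<bar>"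
    by (metis abs_mult abs_triangle_ineq)
  also have "\<dots> \<le> \<bar>a - c\<bar> * 1 + 1 * \<bar>b - d\<bar>"
    using assms by (intro add_mono mult_mono) auto
  finally show ?thesis by simp
qed

text \<open>Measurability and a bound on the full horizon are inherited by every initial
  subinterval, whose measure is finite.\<close>

lemma bounded_measurable_integrable:
  fixes f :: "real \<Rightarrow> real"
  assumes f: "f \<in> borel_measurable (lebesgue_on {a..T})"
    and B: "\<And>t. t \<in> {a..T} \<Longrightarrow> \<bar>f t\<bar> \<le> B" and "t \<le> T"
  shows "integrable (lebesgue_on {a..t}) f"
proof (rule finite_measure.integrable_const_bound)
  show "finite_measure (lebesgue_on {a..t})" by (simp add: finite_measure_lebesgue_on)
  show "AE s in lebesgue_on {a..t}. norm (f s) \<le> B"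
    using B \<open>t \<le> T\<close> by (intro AE_I2) simp
  show "f \<in> borel_measurable (lebesgue_on {a..t})"
    using \<open>t \<le> T\<close> by (intro measurable_restrict_mono[OF f]) auto
qed

section \<open>Bounded Lipschitz functionals of the traffic state\<close>

text \<open>The values at a fixed time of the triples in \<open>B_space\<close>; all Lipschitz
  estimates are made here, with time frozen.\<close>

definition states :: "nat \<Rightarrow> (nat \<Rightarrow> nat \<Rightarrow> real) set" where
  "states n = {x. \<forall>r\<in>{1..3}. (\<forall>j\<in>{1..n}. 0 \<le> x r j \<and> x r j \<le> 1) \<and> (\<Sum>j=1..n. x r j) \<le> 1}"

text \<open>Evaluated at time \<open>t\<close>, this is the expression under the supremum in
  \<open>norm_sup\<close>. The same distance measures the gap of the initial data.\<close>

definition sdist :: "nat \<Rightarrow> (nat \<Rightarrow> nat \<Rightarrow> real) \<Rightarrow> (nat \<Rightarrow> nat \<Rightarrow> real) \<Rightarrow> real" where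
  "sdist n x y = (\<Sum>r=1..3. norm1 n (\<lambda>j. x r j - y r j))"

text \<open>Boundedness is part of the notion because a product of Lipschitz functions need not be
  Lipschitz without it. One constant serves for both properties.\<close>

definition bdd_lip :: "nat \<Rightarrow> ((nat \<Rightarrow> nat \<Rightarrow> real) \<Rightarrow> real) \<Rightarrow> bool" where
  "bdd_lip n g \<longleftrightarrow>
     (\<exists>K\<ge>0. \<forall>x\<in>states n. \<bar>g x\<bar> \<le> K \<and> (\<forall>y\<in>states n. \<bar>g x - g y\<bar> \<le> K * sdist n x y))"

lemma sdist_nonneg: "0 \<le> sdist n x y"
  unfolding sdist_def by (intro sum_nonneg norm1_nonneg)

lemma norm1_le_sdist: "r \<in> {1..3} \<Longrightarrow> norm1 n (\<lambda>j. x r j - y r j) \<le> sdist n x y"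
  unfolding sdist_def by (rule member_le_sum) (auto simp: norm1_nonneg)

lemma component_le_sdist:
  "r \<in> {1..3} \<Longrightarrow> j \<in> {1..n} \<Longrightarrow> \<bar>x r j - y r j\<bar> \<le> sdist n x y"
  using abs_le_norm1[of j n "\<lambda>j. x r j - y r j"] norm1_le_sdist[of r n x y] by linarith

lemma density_le_sdist:
  assumes "r \<in> {1..3}"
  shows "\<bar>car_density n (x r) - car_density n (y r)\<bar> \<le> sdist n x y"
proof -
  have "\<bar>car_density n (x r) - car_density n (y r)\<bar> \<le> norm1 n (\<lambda>j. x r j - y r j)"
    unfolding car_density_def norm1_def by (simp flip: sum_subtractf)
  with norm1_le_sdist[OF assms, of n x y] show ?thesis by linarith
qed

lemma statesD:
  assumes "x \<in> states n" "r \<in> {1..3}"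
  shows "j \<in> {1..n} \<Longrightarrow> 0 \<le> x r j" "j \<in> {1..n} \<Longrightarrow> x r j \<le> 1"
    and "car_density n (x r) \<in> {0..1}"
  using assms by (auto simp: states_def car_density_def intro!: sum_nonneg)

lemma bdd_lipI:
  assumes "\<And>x. x \<in> states n \<Longrightarrow> \<bar>g x\<bar> \<le> B"
    and "\<And>x y. x \<in> states n \<Longrightarrow> y \<in> states n \<Longrightarrow> \<bar>g x - g y\<bar> \<le> L * sdist n x y"
  shows "bdd_lip n g"
  unfolding bdd_lip_def
\<comment> \<open>The maximum dominates both given constants, and the \<open>0\<close> secures the
  required sign.\<close>
proof (intro exI[of _ "max 0 (max B L)"] conjI ballI)
  fix x y assume x: "x \<in> states n" and y: "y \<in> states n"
  have "L * sdist n x y \<le> max 0 (max B L) * sdist n x y"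
    by (intro mult_right_mono sdist_nonneg) auto
  with assms(2)[OF x y] show "\<bar>g x - g y\<bar> \<le> max 0 (max B L) * sdist n x y" by linarith
qed (use assms(1) in force)+

lemma bdd_lipE:
  assumes "bdd_lip n g"
  obtains K where "0 \<le> K" "\<And>x. x \<in> states n \<Longrightarrow> \<bar>g x\<bar> \<le> K"
    "\<And>x y. x \<in> states n \<Longrightarrow> y \<in> states n \<Longrightarrow> \<bar>g x - g y\<bar> \<le> K * sdist n x y"
  using assms unfolding bdd_lip_def by blast

lemma bdd_lip_const: "bdd_lip n (\<lambda>x. c)"
  by (rule bdd_lipI[of _ _ "\<bar>c\<bar>" 0]) auto

lemma bdd_lip_add:
  assumes "bdd_lip n f" "bdd_lip n g"
  shows "bdd_lip n (\<lambda>x. f x + g x)"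
proof -
  obtain K where K: "\<And>x. x \<in> states n \<Longrightarrow> \<bar>f x\<bar> \<le> K"
    "\<And>x y. x \<in> states n \<Longrightarrow> y \<in> states n \<Longrightarrow> \<bar>f x - f y\<bar> \<le> K * sdist n x y"
    using assms(1) by (rule bdd_lipE) blast
  obtain L where L: "\<And>x. x \<in> states n \<Longrightarrow> \<bar>g x\<bar> \<le> L"
    "\<And>x y. x \<in> states n \<Longrightarrow> y \<in> states n \<Longrightarrow> \<bar>g x - g y\<bar> \<le> L * sdist n x y"
    using assms(2) by (rule bdd_lipE) blast
  show ?thesis
  proof (rule bdd_lipI[of _ _ "K + L" "K + L"])
    show "\<bar>f x + g x\<bar> \<le> K + L" if "x \<in> states n" for x
      using K(1)[OF that] L(1)[OF that] by linarith
    show "\<bar>f x + g x - (f y + g y)\<bar> \<le> (K + L) * sdist n x y"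
      if "x \<in> states n" "y \<in> states n" for x y
      using K(2)[OF that] L(2)[OF that] unfolding distrib_right by linarith
  qed
qed

text \<open>Product rule: the variation of each factor is weighted by the bound of the other, which
  gives \<open>K * L\<close> twice.\<close>

lemma bdd_lip_mult:
  assumes "bdd_lip n f" "bdd_lip n g"
  shows "bdd_lip n (\<lambda>x. f x * g x)"
proof -
  obtain K where K: "0 \<le> K" "\<And>x. x \<in> states n \<Longrightarrow> \<bar>f x\<bar> \<le> K"
    "\<And>x y. x \<in> states n \<Longrightarrow> y \<in> states n \<Longrightarrow> \<bar>f x - f y\<bar> \<le> K * sdist n x y"
    using assms(1) by (rule bdd_lipE) blast
  obtain L where L: "0 \<le> L" "\<And>x. x \<in> states n \<Longrightarrow> \<bar>g x\<bar> \<le> L"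
    "\<And>x y. x \<in> states n \<Longrightarrow> y \<in> states n \<Longrightarrow> \<bar>g x - g y\<bar> \<le> L * sdist n x y"
    using assms(2) by (rule bdd_lipE) blast
  show ?thesis
  proof (rule bdd_lipI[of _ _ "K * L" "K * L + K * L"])
    show "\<bar>f x * g x\<bar> \<le> K * L" if "x \<in> states n" for x
      unfolding abs_mult using K(1) K(2)[OF that] L(2)[OF that] by (intro mult_mono) auto
    fix x y assume x: "x \<in> states n" and y: "y \<in> states n"
    have "f x * g x - f y * g y = (f x - f y) * g x + f y * (g x - g y)"
      by (simp add: algebra_simps)
    then have "\<bar>f x * g x - f y * g y\<bar> \<le> \<bar>f x - f y\<bar> * \<bar>g x\<bar> + \<bar>f y\<bar> * \<bar>g x - g y\<bar>"
      by (metis abs_mult abs_triangle_ineq)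
    also have "\<dots> \<le> (K * sdist n x y) * L + K * (L * sdist n x y)"
      using K L x y by (intro add_mono mult_mono) (auto simp: sdist_nonneg)
    finally show "\<bar>f x * g x - f y * g y\<bar> \<le> (K * L + K * L) * sdist n x y"
      by (simp add: algebra_simps)
  qed
qed

lemma bdd_lip_diff:
  assumes "bdd_lip n f" "bdd_lip n g"
  shows "bdd_lip n (\<lambda>x. f x - g x)"
  using bdd_lip_add[OF assms(1) bdd_lip_mult[OF bdd_lip_const[of n "-1"] assms(2)]] by simp

text \<open>The condition does not depend on the state, so no matching at a switching surface
  arises. It covers the case distinctions on road and speed class in
  \<open>exchange\<close>.\<close>

lemma bdd_lip_if:
  "bdd_lip n f \<Longrightarrow> bdd_lip n g \<Longrightarrow> bdd_lip n (\<lambda>x. if P then f x else g x)"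
  by (cases P) simp_all

lemma bdd_lip_sum:
  assumes "\<And>i. i \<in> I \<Longrightarrow> bdd_lip n (f i)"
  shows "bdd_lip n (\<lambda>x. \<Sum>i\<in>I. f i x)"
  using assms
  by (induction I rule: infinite_finite_induct) (auto intro: bdd_lip_const bdd_lip_add)

lemma bdd_lip_component:
  assumes "r \<in> {1..3}" "j \<in> {1..n}"
  shows "bdd_lip n (\<lambda>x. x r j)"
  by (rule bdd_lipI[of _ _ 1 1]) (use assms component_le_sdist statesD in \<open>auto simp: abs_le_iff\<close>)

lemma bdd_lip_density: "r \<in> {1..3} \<Longrightarrow> bdd_lip n (\<lambda>x. car_density n (x r))"
  unfolding car_density_def by (intro bdd_lip_sum bdd_lip_component)

text \<open>The outer function is controlled on \<open>U\<close> alone, so the inner values must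
  stay there: \<open>U\<close> is the whole line for \<open>H\<close> and the unit interval for the
  table of games.\<close>

lemma bdd_lip_compose:
  assumes h: "l-lipschitz_on U h" "\<And>u. u \<in> U \<Longrightarrow> \<bar>h u\<bar> \<le> B"
    and g: "bdd_lip n g" "\<And>x. x \<in> states n \<Longrightarrow> g x \<in> U"
  shows "bdd_lip n (\<lambda>x. h (g x))"
proof -
  obtain K where K:
    "\<And>x y. x \<in> states n \<Longrightarrow> y \<in> states n \<Longrightarrow> \<bar>g x - g y\<bar> \<le> K * sdist n x y"
    using g(1) by (rule bdd_lipE) blast
  show ?thesis
  proof (rule bdd_lipI[of _ _ B "l * K"])
    fix x y assume x: "x \<in> states n" and y: "y \<in> states n"
    have "\<bar>h (g x) - h (g y)\<bar> \<le> l * \<bar>g x - g y\<bar>"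
      using lipschitz_onD[OF h(1) g(2)[OF x] g(2)[OF y]] by (simp add: dist_real_def)
    also have "\<dots> \<le> l * (K * sdist n x y)"
      by (intro mult_left_mono K x y lipschitz_on_nonneg[OF h(1)])
    finally show "\<bar>h (g x) - h (g y)\<bar> \<le> l * K * sdist n x y" by simp
  qed (use assms in auto)
qed

lemma continuous_on_sdist:
  assumes "\<And>r. r \<in> {1..3} \<Longrightarrow> F r \<in> X_space T n" "\<And>r. r \<in> {1..3} \<Longrightarrow> G r \<in> X_space T n"
  shows "continuous_on {0..T} (\<lambda>t. sdist n (\<lambda>r. F r t) (\<lambda>r. G r t))"
  unfolding sdist_def norm1_def
  using assms by (auto simp: X_space_def intro!: continuous_intros)

text \<open>The variation of \<open>g\<close> along the path is squeezed by \<open>K\<close> times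
  the distance to the state at time \<open>t\<close>, which is continuous and vanishes at
  \<open>t\<close>.\<close>

lemma bdd_lip_continuous_on:
  assumes g: "bdd_lip n g" and F: "\<And>r. r \<in> {1..3} \<Longrightarrow> F r \<in> X_space T n"
    and S: "\<And>t. t \<in> {0..T} \<Longrightarrow> (\<lambda>r. F r t) \<in> states n"
  shows "continuous_on {0..T} (\<lambda>t. g (\<lambda>r. F r t))"
proof -
  obtain K where K:
    "\<And>x y. x \<in> states n \<Longrightarrow> y \<in> states n \<Longrightarrow> \<bar>g x - g y\<bar> \<le> K * sdist n x y"
    using g by (rule bdd_lipE) blast
  show ?thesis
    unfolding continuous_on_def
  proof
    fix t assume t: "t \<in> {0..T}"
    have "continuous_on {0..T} (\<lambda>s. sdist n (\<lambda>r. F r s) (\<lambda>r. F r t))"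
      unfolding sdist_def norm1_def using F by (auto simp: X_space_def intro!: continuous_intros)
    then have "((\<lambda>s. sdist n (\<lambda>r. F r s) (\<lambda>r. F r t)) \<longlongrightarrow> sdist n (\<lambda>r. F r t) (\<lambda>r. F r t))
        (at t within {0..T})"
      using t unfolding continuous_on_def by blast
    then have lim: "((\<lambda>s. K * sdist n (\<lambda>r. F r s) (\<lambda>r. F r t)) \<longlongrightarrow> 0) (at t within {0..T})"
      by (auto simp: sdist_def norm1_def intro: tendsto_mult_right_zero)
    have "((\<lambda>s. g (\<lambda>r. F r s) - g (\<lambda>r. F r t)) \<longlongrightarrow> 0) (at t within {0..T})"
    proof (rule Lim_null_comparison[OF _ lim])
      show "\<forall>\<^sub>F s in at t within {0..T}. norm (g (\<lambda>r. F r s) - g (\<lambda>r. F r t))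
          \<le> K * sdist n (\<lambda>r. F r s) (\<lambda>r. F r t)"
        unfolding eventually_at_filter
        using K S t by (auto intro!: always_eventually)
    qed
    then show "((\<lambda>s. g (\<lambda>r. F r s)) \<longlongrightarrow> g (\<lambda>r. F r t)) (at t within {0..T})"
      by (simp add: LIM_zero_iff)
  qed
qed

section \<open>The source terms of the junction\<close>

locale junction =
  fixes n :: nat and v :: "nat \<Rightarrow> real" and p \<eta> \<epsilon> :: real and H :: "real \<Rightarrow> real"
    and A :: "nat \<Rightarrow> nat \<Rightarrow> nat \<Rightarrow> real \<Rightarrow> real" and \<Phi> :: "real \<Rightarrow> real \<Rightarrow> real"
  assumes n: "n \<ge> 2" and v1: "v 1 = 0" and v_mono: "strict_mono_on {1..n} v"
    and vn: "v n = 1" and p: "p \<le> v 2"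
    and H: "regularized_step \<epsilon> H" and A: "table_of_games n A" and \<Phi>: "flux_limiter \<Phi>"
begin

text \<open>\<open>merge\<close>, \<open>inflow_density\<close> and \<open>limiter\<close> are the
  junction quantities at a frozen state; \<open>mild_eq\<close> identifies them with
  \<open>merge_factor\<close> and \<open>junction_limiter\<close> along a solution.\<close>

definition merge :: "(nat \<Rightarrow> nat \<Rightarrow> real) \<Rightarrow> real" where
  "merge x = H (p - (car_flux n v (x 1) + car_flux n v (x 2)))"

definition inflow_density :: "(nat \<Rightarrow> nat \<Rightarrow> real) \<Rightarrow> real" where
  "inflow_density x = (\<Sum>j=2..n. x 1 j + merge x * x 2 j)"

definition limiter :: "(nat \<Rightarrow> nat \<Rightarrow> real) \<Rightarrow> real" where
  "limiter x = \<Phi> (inflow_density x) (car_density n (x 3))"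

definition exchange :: "nat \<Rightarrow> nat \<Rightarrow> (nat \<Rightarrow> nat \<Rightarrow> real) \<Rightarrow> real" where
  "exchange r j x =
     (if r = 1 then - v j * (limiter x * x 1 j)
      else if r = 2 then - v j * (merge x * limiter x * x 2 j)
      else v j * (limiter x * (x 1 j + merge x * x 2 j) * (if j = 1 then 0 else 1)))"

definition autonomous :: "nat \<Rightarrow> nat \<Rightarrow> (nat \<Rightarrow> nat \<Rightarrow> real) \<Rightarrow> real" where
  "autonomous r j x = exchange r j x + (gain n \<eta> A (x r) j - x r j * loss n \<eta> (x r))"

text \<open>The limiter values \<open>b\<close> are free parameters here, although those of roads 1
  and 2 depend on the solution. Their difference thus survives as a term of its own, as the
  stability estimate demands.\<close>

definition boundary ::
    "(nat \<Rightarrow> real) \<Rightarrow> (nat \<Rightarrow> nat \<Rightarrow> real) \<Rightarrow> nat \<Rightarrow> nat \<Rightarrow> (nat \<Rightarrow> nat \<Rightarrow> real) \<Rightarrow> real" where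
  "boundary b w r j x = (if r = 3 then - v j * (b 3 * x 3 j) else v j * (b r * w r j))"

section \<open>Ranges of the speeds, the inflow density and the limiter\<close>

lemma v_bounds:
  assumes "j \<in> {1..n}"
  shows "0 \<le> v j" "v j \<le> 1"
proof -
  have "v 1 \<le> v j" "v j \<le> v n"
    using strict_mono_on_leD[OF v_mono, of 1 j] strict_mono_on_leD[OF v_mono, of j n] assms n
    by auto
  then show "0 \<le> v j" "v j \<le> 1" using v1 vn by auto
qed

lemma H_range: "0 \<le> H u \<and> H u \<le> 1"
  using H unfolding regularized_step_def by (metis le_cases not_le order_refl zero_le_one)

lemma inflow_density_range:
  assumes x: "x \<in> states n"
  shows "inflow_density x \<in> {0..1}"
proof -
  have nonneg: "0 \<le> x r j" if "r \<in> {1..3}" "j \<in> {1..n}" for r j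
    using statesD(1)[OF x that] .
  have m: "0 \<le> merge x" "merge x \<le> 1" using H_range by (auto simp: merge_def)
  have "0 \<le> inflow_density x"
    unfolding inflow_density_def
    by (intro sum_nonneg add_nonneg_nonneg mult_nonneg_nonneg m nonneg) auto
  moreover have "inflow_density x \<le> 1"
  proof (cases "car_flux n v (x 1) + car_flux n v (x 2) < p")
    \<comment> \<open>A positive merge factor forces the total flux below \<open>p \<le> v 2\<close>, and every moving
        vehicle contributes at least \<open>v 2\<close> to it.\<close>
    case True
    have v2: "0 < v 2"
      using strict_mono_onD[OF v_mono, of 1 2] n v1 by simp
    have "v 2 * inflow_density x = (\<Sum>j=2..n. v 2 * (x 1 j + merge x * x 2 j))"
      by (simp add: inflow_density_def sum_distrib_left)
    also have "\<dots> \<le> (\<Sum>j=2..n. v j * x 1 j + v j * x 2 j)"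
    proof (rule sum_mono)
      fix j assume j: "j \<in> {2..n}"
      have "v 2 \<le> v j" using strict_mono_on_leD[OF v_mono, of 2 j] j by simp
      moreover have "merge x * x 2 j \<le> x 2 j"
        using m nonneg[of 2 j] j by (simp add: mult_left_le_one_le)
      ultimately have "v 2 * (x 1 j + merge x * x 2 j) \<le> v j * (x 1 j + x 2 j)"
        using v2 m nonneg[of 1 j] nonneg[of 2 j] j by (intro mult_mono) auto
      then show "v 2 * (x 1 j + merge x * x 2 j) \<le> v j * x 1 j + v j * x 2 j"
        by (simp add: distrib_left)
    qed
    also have "\<dots> \<le> (\<Sum>j=1..n. v j * x 1 j + v j * x 2 j)"
      by (rule sum_mono2) (auto intro!: add_nonneg_nonneg mult_nonneg_nonneg v_bounds nonneg)
    also have "\<dots> \<le> v 2"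
      using True p by (simp add: car_flux_def sum.distrib)
    finally show ?thesis using v2 by simp
  next
    case False
    \<comment> \<open>The argument of \<open>H\<close> is nonpositive, so road 2 is shut off and the
      inflow density is at most the density of road 1.\<close>
    then have "merge x = 0"
      using H unfolding merge_def regularized_step_def by auto
    then have "inflow_density x = (\<Sum>j=2..n. x 1 j)" by (simp add: inflow_density_def)
    also have "\<dots> \<le> (\<Sum>j=1..n. x 1 j)" by (rule sum_mono2) (auto intro!: nonneg)
    also have "\<dots> \<le> 1" using x by (simp add: states_def)
    finally show ?thesis .
  qed
  ultimately show ?thesis by simp
qed

lemma \<Phi>_range: "a \<in> {0..1} \<Longrightarrow> b \<in> {0..1} \<Longrightarrow> 0 \<le> \<Phi> a b \<and> \<Phi> a b \<le> 1"
  using \<Phi> unfolding flux_limiter_def by blast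

lemma \<Phi>_lipschitz:
  obtains l where "l > 0"
    "\<And>a b c d. a \<in> {0..1} \<Longrightarrow> b \<in> {0..1} \<Longrightarrow> c \<in> {0..1} \<Longrightarrow> d \<in> {0..1} \<Longrightarrow>
      \<bar>\<Phi> a b - \<Phi> c d\<bar> \<le> l * (\<bar>a - c\<bar> + \<bar>b - d\<bar>)"
  using \<Phi> unfolding flux_limiter_def by blast

lemma continuous_on_\<Phi>:
  assumes "continuous_on S f" "continuous_on S g" "f ` S \<subseteq> {0..1}" "g ` S \<subseteq> {0..1}"
  shows "continuous_on S (\<lambda>t. \<Phi> (f t) (g t))"
proof -
  obtain l where l: "l > 0"
    "\<And>a b c d. a \<in> {0..1} \<Longrightarrow> b \<in> {0..1} \<Longrightarrow> c \<in> {0..1} \<Longrightarrow> d \<in> {0..1} \<Longrightarrow>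
      \<bar>\<Phi> a b - \<Phi> c d\<bar> \<le> l * (\<bar>a - c\<bar> + \<bar>b - d\<bar>)"
    by (rule \<Phi>_lipschitz) blast
  \<comment> \<open>The hypothesis on \<open>\<Phi>\<close> adds the distances of the two
    coordinates. Each of them is at most the Euclidean distance of the pairs, hence the factor
    2.\<close>
  have "(2 * l)-lipschitz_on ({0..1} \<times> {0..1}) (\<lambda>z. \<Phi> (fst z) (snd z))"
  proof (rule lipschitz_onI)
    fix z w :: "real \<times> real" assume z: "z \<in> {0..1} \<times> {0..1}" and w: "w \<in> {0..1} \<times> {0..1}"
    have "\<bar>\<Phi> (fst z) (snd z) - \<Phi> (fst w) (snd w)\<bar>
        \<le> l * (dist (fst z) (fst w) + dist (snd z) (snd w))"
      unfolding dist_real_def using z w by (intro l) auto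
    also have "\<dots> \<le> l * (dist z w + dist z w)"
      using l(1) by (intro mult_left_mono add_mono dist_fst_le dist_snd_le) auto
    finally show "dist (\<Phi> (fst z) (snd z)) (\<Phi> (fst w) (snd w)) \<le> 2 * l * dist z w"
      by (simp add: dist_real_def)
  qed (use l in simp)
  then have "continuous_on ({0..1} \<times> {0..1}) (\<lambda>z. \<Phi> (fst z) (snd z))"
    by (rule lipschitz_on_continuous_on)
  from continuous_on_compose2[OF this continuous_on_Pair[OF assms(1,2)]] assms(3,4)
  show ?thesis by auto
qed

section \<open>Lipschitz bounds for the source terms\<close>

text \<open>The regularization enters here: \<open>H\<close> is globally Lipschitz with values in
  the unit interval, and its argument is affine in the state.\<close>

lemma bdd_lip_merge: "bdd_lip n merge"
proof -
  obtain l where l: "l-lipschitz_on UNIV H" using H unfolding regularized_step_def by blast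
  have "bdd_lip n (\<lambda>x. p - (car_flux n v (x 1) + car_flux n v (x 2)))"
    unfolding car_flux_def
    by (intro bdd_lip_diff bdd_lip_add bdd_lip_sum bdd_lip_mult bdd_lip_const bdd_lip_component) auto
  then have "bdd_lip n (\<lambda>x. H (p - (car_flux n v (x 1) + car_flux n v (x 2))))"
    by (rule bdd_lip_compose[OF l, rotated, where B = 1]) (use H_range in auto)
  then show ?thesis by (simp add: merge_def[abs_def])
qed

lemma bdd_lip_inflow_density: "bdd_lip n inflow_density"
  unfolding inflow_density_def[abs_def]
  by (intro bdd_lip_add bdd_lip_sum bdd_lip_mult bdd_lip_merge bdd_lip_component) auto

lemma bdd_lip_limiter: "bdd_lip n limiter"
proof -
  obtain l where l: "l > 0"
    "\<And>a b c d. a \<in> {0..1} \<Longrightarrow> b \<in> {0..1} \<Longrightarrow> c \<in> {0..1} \<Longrightarrow> d \<in> {0..1} \<Longrightarrow>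
      \<bar>\<Phi> a b - \<Phi> c d\<bar> \<le> l * (\<bar>a - c\<bar> + \<bar>b - d\<bar>)"
    by (rule \<Phi>_lipschitz) blast
  obtain K where K: "\<And>x y. x \<in> states n \<Longrightarrow> y \<in> states n \<Longrightarrow>
      \<bar>inflow_density x - inflow_density y\<bar> \<le> K * sdist n x y"
    using bdd_lip_inflow_density by (rule bdd_lipE) blast
  show ?thesis
  \<comment> \<open>\<open>K\<close> accounts for the first argument of \<open>\<Phi>\<close> and
    the \<open>1\<close> for the density of road 3. By \<open>inflow_density_range\<close> both
    arguments stay in the unit square, where \<open>\<Phi>\<close> is controlled.\<close>
  proof (rule bdd_lipI[of _ _ 1 "l * (K + 1)"])
    show "\<bar>limiter x\<bar> \<le> 1" if "x \<in> states n" for x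
      using \<Phi>_range[OF inflow_density_range[OF that] statesD(3)[OF that, of 3]]
      by (simp add: limiter_def)
    fix x y assume x: "x \<in> states n" and y: "y \<in> states n"
    have "\<bar>limiter x - limiter y\<bar>
        \<le> l * (\<bar>inflow_density x - inflow_density y\<bar> + \<bar>car_density n (x 3) - car_density n (y 3)\<bar>)"
      unfolding limiter_def using x y
      by (intro l inflow_density_range statesD(3)) auto
    also have "\<dots> \<le> l * (K * sdist n x y + sdist n x y)"
      using l(1) K[OF x y] density_le_sdist[of 3 n x y]
      by (intro mult_left_mono add_mono) auto
    finally show "\<bar>limiter x - limiter y\<bar> \<le> l * (K + 1) * sdist n x y"
      by (simp add: algebra_simps)
  qed
qed

lemma bdd_lip_exchange:
  assumes "j \<in> {1..n}"
  shows "bdd_lip n (exchange r j)"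
  unfolding exchange_def[abs_def]
  by (intro bdd_lip_if bdd_lip_add bdd_lip_mult bdd_lip_merge bdd_lip_limiter bdd_lip_component
      bdd_lip_const) (use assms in auto)

text \<open>The entry is composed with the density, which lies in the unit interval; the bound 1
  comes from nonnegative probabilities with sum one.\<close>

lemma bdd_lip_game:
  assumes "h \<in> {1..n}" "k \<in> {1..n}" "j \<in> {1..n}" "r \<in> {1..3}"
  shows "bdd_lip n (\<lambda>x. A j h k (car_density n (x r)))"
proof -
  obtain l where l: "l-lipschitz_on {0..1} (A j h k)"
    using A assms unfolding table_of_games_def by blast
  show ?thesis
  proof (rule bdd_lip_compose[OF l _ bdd_lip_density[OF assms(4)]])
    show "\<bar>A j h k u\<bar> \<le> 1" if "u \<in> {0..1}" for u
    proof -
      have nonneg: "\<forall>i\<in>{1..n}. 0 \<le> A i h k u" and one: "(\<Sum>i=1..n. A i h k u) = 1"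
        using A assms that unfolding table_of_games_def by blast+
      have "A j h k u \<le> (\<Sum>i=1..n. A i h k u)"
        using assms(3) nonneg by (intro member_le_sum) auto
      with nonneg one assms(3) show ?thesis by auto
    qed
  qed (rule statesD(3)[OF _ assms(4)])
qed

text \<open>Gain and loss are polynomial in the components, with table entries as coefficients, so
  the closure rules for sums and products suffice.\<close>

lemma bdd_lip_autonomous:
  assumes "r \<in> {1..3}" "j \<in> {1..n}"
  shows "bdd_lip n (autonomous r j)"
  unfolding autonomous_def[abs_def] gain_def loss_def power2_eq_square
  using assms
  by (intro bdd_lip_add bdd_lip_diff bdd_lip_mult bdd_lip_sum bdd_lip_exchange bdd_lip_game
      bdd_lip_density bdd_lip_component bdd_lip_const)

text \<open>The speed is at most 1 and drops out; the remaining product of a limiter and a density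
  is telescoped. On road 3 the density belongs to the solution, so a state difference appears in
  place of a data difference.\<close>

lemma boundary_diff_le:
  assumes j: "j \<in> {1..n}" and y: "\<bar>y 3 j\<bar> \<le> 1"
    and b: "\<bar>b r\<bar> \<le> 1" and w: "r \<noteq> 3 \<Longrightarrow> \<bar>w' r j\<bar> \<le> 1"
  shows "\<bar>boundary b' w' r j y - boundary b w r j x\<bar> \<le> \<bar>b' r - b r\<bar> +
    (if r = 3 then \<bar>y 3 j - x 3 j\<bar> else \<bar>w' r j - w r j\<bar>)"
proof -
  have *: "\<bar>v j * c\<bar> \<le> \<bar>c\<bar>" for c
    using v_bounds[OF j] by (simp add: abs_mult mult_left_le_one_le)
  show ?thesis
  proof (cases "r = 3")
    case True
    have "boundary b' w' r j y - boundary b w r j x = - (v j * (b' 3 * y 3 j - b 3 * x 3 j))"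
      by (simp add: boundary_def True algebra_simps)
    then have "\<bar>boundary b' w' r j y - boundary b w r j x\<bar> \<le> \<bar>b' 3 * y 3 j - b 3 * x 3 j\<bar>"
      using * by simp
    also have "\<dots> \<le> \<bar>b' 3 - b 3\<bar> + \<bar>y 3 j - x 3 j\<bar>"
      using y b True by (intro abs_mult_diff_le) auto
    finally show ?thesis using True by simp
  next
    case False
    have "boundary b' w' r j y - boundary b w r j x = v j * (b' r * w' r j - b r * w r j)"
      by (simp add: boundary_def False algebra_simps)
    then have "\<bar>boundary b' w' r j y - boundary b w r j x\<bar> \<le> \<bar>b' r * w' r j - b r * w r j\<bar>"
      using * by simp
    also have "\<dots> \<le> \<bar>b' r - b r\<bar> + \<bar>w' r j - w r j\<bar>"
      using w b False by (intro abs_mult_diff_le) auto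
    finally show ?thesis using False by simp
  qed
qed

lemma autonomous_lipschitz:
  obtains K where "0 \<le> K" "\<And>x y. x \<in> states n \<Longrightarrow> y \<in> states n \<Longrightarrow>
    (\<Sum>r=1..3. \<Sum>j=1..n. \<bar>autonomous r j y - autonomous r j x\<bar>) \<le> K * sdist n y x"
proof -
  have "\<forall>r\<in>{1..3}. \<forall>j\<in>{1..n}. \<exists>K\<ge>0. \<forall>y\<in>states n. \<forall>x\<in>states n.
      \<bar>autonomous r j y - autonomous r j x\<bar> \<le> K * sdist n y x"
    using bdd_lip_autonomous unfolding bdd_lip_def by meson
  then obtain K where K: "\<And>r j. r \<in> {1..3} \<Longrightarrow> j \<in> {1..n} \<Longrightarrow> K r j \<ge> 0 \<and>
      (\<forall>y\<in>states n. \<forall>x\<in>states n. \<bar>autonomous r j y - autonomous r j x\<bar> \<le> K r j * sdist n y x)"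
    by metis
  show ?thesis
  \<comment> \<open>Adding the finitely many componentwise constants bounds the sum of the
    differences.\<close>
  proof (rule that[of "\<Sum>r=1..3. \<Sum>j=1..n. K r j"])
    show "0 \<le> (\<Sum>r=1..3. \<Sum>j=1..n. K r j)"
      using K by (intro sum_nonneg) auto
    show "(\<Sum>r=1..3. \<Sum>j=1..n. \<bar>autonomous r j y - autonomous r j x\<bar>)
        \<le> (\<Sum>r=1..3. \<Sum>j=1..n. K r j) * sdist n y x"
      if "x \<in> states n" "y \<in> states n" for x y
      unfolding sum_distrib_right using K that by (intro sum_mono) auto
  qed
qed

section \<open>Comparison of two mild solutions\<close>

abbreviation mild where
  "mild T \<equiv> mild_solution T n v p H \<eta> A \<Phi>"

abbreviation source where
  "source fb \<Phi>3 F r j s \<equiv>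
     boundary (\<lambda>r. bdry_limiter n \<Phi> fb \<Phi>3 F r s) (\<lambda>r. fb r s) r j (\<lambda>r. F r s)
     + autonomous r j (\<lambda>r. F r s)"

text \<open>The integrand on the right of the stability estimate. The solutions are arguments
  because the limiters of roads 1 and 2 depend on them.\<close>

definition data_gap where
  "data_gap fb \<Phi>f3 F gb \<Phi>g3 G t =
     (\<Sum>r=1..3. \<bar>bdry_limiter n \<Phi> gb \<Phi>g3 G r t - bdry_limiter n \<Phi> fb \<Phi>f3 F r t\<bar>) +
     (\<Sum>r=1..2. norm1 n (\<lambda>j. gb r t j - fb r t j))"

lemma data_gap_nonneg: "0 \<le> data_gap fb \<Phi>f3 F gb \<Phi>g3 G t"
  unfolding data_gap_def by (intro add_nonneg_nonneg sum_nonneg norm1_nonneg) auto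

lemma B_spaceD:
  assumes "u \<in> B_space T n"
  shows "u \<in> X_space T n"
    and "\<And>t j. t \<in> {0..T} \<Longrightarrow> j \<in> {1..n} \<Longrightarrow> 0 \<le> u t j \<and> u t j \<le> 1"
    and "\<And>j. j \<in> {1..n} \<Longrightarrow> continuous_on {0..T} (\<lambda>t. u t j)"
    and "continuous_on {0..T} (\<lambda>t. car_density n (u t))"
    and "(\<lambda>t. car_density n (u t)) ` {0..T} \<subseteq> {0..1}"
  using assms
  by (auto simp: B_space_def X_space_def car_density_def intro!: continuous_on_sum sum_nonneg)

lemma mild_states:
  assumes "mild T \<phi> fb \<Phi>3 F" "t \<in> {0..T}"
  shows "(\<lambda>r. F r t) \<in> states n"
  using assms unfolding mild_solution_def states_def B_space_def by blast

lemma mild_B_space: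
  assumes "mild T \<phi> fb \<Phi>3 F" "r \<in> {1..3}"
  shows "F r \<in> B_space T n"
  using assms unfolding mild_solution_def by blast

text \<open>The three integrands are regrouped into a boundary and an autonomous part, so that one
  formula covers all roads.\<close>

lemma mild_eq:
  assumes F: "mild T \<phi> fb \<Phi>3 F" and "t \<in> {0..T}" "r \<in> {1..3}" "j \<in> {1..n}"
  shows "F r t j = \<phi> r j + (LINT s|lebesgue_on {0..t}. source fb \<Phi>3 F r j s)"
proof -
  have m: "merge (\<lambda>r. F r s) = merge_factor n v p H F s"
    and l: "limiter (\<lambda>r. F r s) = junction_limiter n v p H \<Phi> F s" for s
    by (simp_all add: merge_def merge_factor_def limiter_def inflow_density_def
        junction_limiter_def)
  consider "r = 1" | "r = 2" | "r = 3" using assms(3) by force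
  then show ?thesis
  proof cases
    case 1
    have "source fb \<Phi>3 F 1 j s = v j * (bdry_limiter n \<Phi> fb \<Phi>3 F 1 s * fb 1 s j
        - junction_limiter n v p H \<Phi> F s * F 1 s j)
        + gain n \<eta> A (F 1 s) j - F 1 s j * loss n \<eta> (F 1 s)" for s
      by (simp add: boundary_def autonomous_def exchange_def m l algebra_simps)
    then show ?thesis using F assms(2,4) 1 unfolding mild_solution_def by simp
  next
    case 2
    have "source fb \<Phi>3 F 2 j s = v j * (bdry_limiter n \<Phi> fb \<Phi>3 F 2 s * fb 2 s j
        - merge_factor n v p H F s * junction_limiter n v p H \<Phi> F s * F 2 s j)
        + gain n \<eta> A (F 2 s) j - F 2 s j * loss n \<eta> (F 2 s)" for s
      by (simp add: boundary_def autonomous_def exchange_def m l algebra_simps)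
    then show ?thesis using F assms(2,4) 2 unfolding mild_solution_def by simp
  next
    case 3
    have "source fb \<Phi>3 F 3 j s = v j * (junction_limiter n v p H \<Phi> F s
          * (F 1 s j + merge_factor n v p H F s * F 2 s j) * (if j = 1 then 0 else 1)
          - bdry_limiter n \<Phi> fb \<Phi>3 F 3 s * F 3 s j)
        + gain n \<eta> A (F 3 s) j - F 3 s j * loss n \<eta> (F 3 s)" for s
      by (simp add: boundary_def autonomous_def exchange_def m l algebra_simps)
    then show ?thesis using F assms(2,4) 3 unfolding mild_solution_def by simp
  qed
qed

section \<open>Measurability and integrability in time\<close>

lemma bdry_limiter_range:
  assumes "junction_data T n \<phi> fb \<Phi>3" "mild T \<phi> fb \<Phi>3 F" "r \<in> {1..3}" "t \<in> {0..T}"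
  shows "0 \<le> bdry_limiter n \<Phi> fb \<Phi>3 F r t \<and> bdry_limiter n \<Phi> fb \<Phi>3 F r t \<le> 1"
proof (cases "r = 3")
  case True
  then show ?thesis using assms unfolding junction_data_def bdry_limiter_def by simp
next
  case False
  then have "fb r \<in> B_space T n" using assms unfolding junction_data_def by auto
  from B_spaceD(5)[OF this] B_spaceD(5)[OF mild_B_space[OF assms(2,3)]] assms(4) False
  show ?thesis unfolding bdry_limiter_def by (auto simp: image_subset_iff intro!: \<Phi>_range)
qed

text \<open>On road 3 measurability is part of the data; on roads 1 and 2 the limiter is continuous,
  being \<open>\<Phi>\<close> of two continuous densities.\<close>

lemma bdry_limiter_measurable:
  assumes "junction_data T n \<phi> fb \<Phi>3" "mild T \<phi> fb \<Phi>3 F" "r \<in> {1..3}"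
  shows "bdry_limiter n \<Phi> fb \<Phi>3 F r \<in> borel_measurable (lebesgue_on {0..T})"
proof (cases "r = 3")
  case True
  then have "bdry_limiter n \<Phi> fb \<Phi>3 F r = \<Phi>3" by (auto simp: bdry_limiter_def)
  then show ?thesis using assms unfolding junction_data_def by simp
next
  case False
  then have fb: "fb r \<in> B_space T n" using assms unfolding junction_data_def by auto
  have F: "F r \<in> B_space T n" by (rule mild_B_space[OF assms(2,3)])
  have "bdry_limiter n \<Phi> fb \<Phi>3 F r
      = (\<lambda>t. \<Phi> (car_density n (fb r t)) (car_density n (F r t)))"
    using False by (auto simp: bdry_limiter_def)
  then have "continuous_on {0..T} (bdry_limiter n \<Phi> fb \<Phi>3 F r)"
    using B_spaceD(4,5)[OF fb] B_spaceD(4,5)[OF F] by (simp add: continuous_on_\<Phi>)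
  then show ?thesis by (rule continuous_imp_measurable_on_sets_lebesgue) simp
qed

lemma bdry_limiter_integrable:
  assumes "junction_data T n \<phi> fb \<Phi>3" "mild T \<phi> fb \<Phi>3 F" "r \<in> {1..3}" "t \<in> {0..T}"
  shows "integrable (lebesgue_on {0..t}) (bdry_limiter n \<Phi> fb \<Phi>3 F r)"
  using bdry_limiter_measurable[OF assms(1-3)] bdry_limiter_range[OF assms(1-3)] assms(4)
  by (intro bounded_measurable_integrable[where T = T and B = 1]) auto

lemma source_integrable:
  assumes d: "junction_data T n \<phi> fb \<Phi>3" and m: "mild T \<phi> fb \<Phi>3 F"
    and r: "r \<in> {1..3}" and j: "j \<in> {1..n}" and t: "t \<in> {0..T}"
  shows "integrable (lebesgue_on {0..t}) (source fb \<Phi>3 F r j)"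
proof (rule Bochner_Integration.integrable_add)
  have "continuous_on {0..T} (\<lambda>s. autonomous r j (\<lambda>r. F r s))"
    by (rule bdd_lip_continuous_on[OF bdd_lip_autonomous[OF r j]])
      (use mild_B_space[OF m] B_spaceD(1) mild_states[OF m] in auto)
  then have "continuous_on {0..t} (\<lambda>s. autonomous r j (\<lambda>r. F r s))"
    by (rule continuous_on_subset) (use t in auto)
  then show "integrable (lebesgue_on {0..t}) (\<lambda>s. autonomous r j (\<lambda>r. F r s))"
    by (rule continuous_imp_integrable_real)
next
  \<comment> \<open>The sign encodes that road 3 loses vehicles at its boundary. With it, the
    boundary term is \<open>v j\<close> times limiter times \<open>w\<close> on every road.\<close>
  define w where "w s = (if r = 3 then - F 3 s j else fb r s j)" for s
  have u: "(if r = 3 then F 3 else fb r) \<in> B_space T n"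
    using d r mild_B_space[OF m, of 3] unfolding junction_data_def by auto
  have w_le: "\<bar>w s\<bar> \<le> 1" if "s \<in> {0..T}" for s
    using B_spaceD(2)[OF u that j] by (auto simp: w_def split: if_splits)
  have "continuous_on {0..T} w"
    using B_spaceD(3)[OF u j] by (cases "r = 3") (auto simp: w_def[abs_def] intro: continuous_on_minus)
  then have w_meas: "w \<in> borel_measurable (lebesgue_on {0..T})"
    by (rule continuous_imp_measurable_on_sets_lebesgue) simp
  have "integrable (lebesgue_on {0..t}) (\<lambda>s. bdry_limiter n \<Phi> fb \<Phi>3 F r s * w s)"
  proof (rule bounded_measurable_integrable[where T = T and B = 1])
    show "(\<lambda>s. bdry_limiter n \<Phi> fb \<Phi>3 F r s * w s) \<in> borel_measurable (lebesgue_on {0..T})"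
      by (intro borel_measurable_times bdry_limiter_measurable[OF d m r] w_meas)
    show "\<bar>bdry_limiter n \<Phi> fb \<Phi>3 F r s * w s\<bar> \<le> 1" if "s \<in> {0..T}" for s
      using bdry_limiter_range[OF d m r that] w_le[OF that]
      by (simp add: abs_mult mult_le_one)
  qed (use t in simp)
  then have "integrable (lebesgue_on {0..t}) (\<lambda>s. v j * (bdry_limiter n \<Phi> fb \<Phi>3 F r s * w s))"
    by (rule integrable_mult_right)
  moreover have "boundary (\<lambda>r. bdry_limiter n \<Phi> fb \<Phi>3 F r s) (\<lambda>r. fb r s) r j (\<lambda>r. F r s)
      = v j * (bdry_limiter n \<Phi> fb \<Phi>3 F r s * w s)" for s
    by (simp add: boundary_def w_def)
  ultimately show "integrable (lebesgue_on {0..t})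
      (\<lambda>s. boundary (\<lambda>r. bdry_limiter n \<Phi> fb \<Phi>3 F r s) (\<lambda>r. fb r s) r j (\<lambda>r. F r s))"
    by simp
qed

lemma data_gap_integrable:
  assumes f: "junction_data T n \<phi> fb \<Phi>f3" "mild T \<phi> fb \<Phi>f3 F"
    and g: "junction_data T n \<psi> gb \<Phi>g3" "mild T \<psi> gb \<Phi>g3 G" and t: "t \<in> {0..T}"
  shows "integrable (lebesgue_on {0..t}) (data_gap fb \<Phi>f3 F gb \<Phi>g3 G)"
proof -
  have *: "integrable (lebesgue_on {0..t}) (\<lambda>s. gb r s j - fb r s j)"
    if "r \<in> {1..2}" "j \<in> {1..n}" for r j
  proof (rule continuous_imp_integrable_real, rule continuous_on_subset)
    show "continuous_on {0..T} (\<lambda>s. gb r s j - fb r s j)"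
      using f(1) g(1) that unfolding junction_data_def
      by (intro continuous_on_diff B_spaceD(3)) auto
  qed (use t in auto)
  show ?thesis
    unfolding data_gap_def[abs_def] norm1_def
    by (intro Bochner_Integration.integrable_add Bochner_Integration.integrable_sum integrable_abs
        Bochner_Integration.integrable_diff bdry_limiter_integrable[OF f _ t]
        bdry_limiter_integrable[OF g _ t] *)
qed

section \<open>The integral inequality for the distance of two solutions\<close>

lemma source_diff_le:
  obtains K where "0 \<le> K" "\<And>T \<phi> fb \<Phi>f3 F \<psi> gb \<Phi>g3 G s.
    junction_data T n \<phi> fb \<Phi>f3 \<Longrightarrow> mild T \<phi> fb \<Phi>f3 F \<Longrightarrow>
    junction_data T n \<psi> gb \<Phi>g3 \<Longrightarrow> mild T \<psi> gb \<Phi>g3 G \<Longrightarrow> s \<in> {0..T} \<Longrightarrow>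
    (\<Sum>r=1..3. \<Sum>j=1..n. \<bar>source gb \<Phi>g3 G r j s - source fb \<Phi>f3 F r j s\<bar>)
      \<le> n * data_gap fb \<Phi>f3 F gb \<Phi>g3 G s + K * sdist n (\<lambda>r. G r s) (\<lambda>r. F r s)"
proof -
  obtain K where K: "0 \<le> K" "\<And>x y. x \<in> states n \<Longrightarrow> y \<in> states n \<Longrightarrow>
    (\<Sum>r=1..3. \<Sum>j=1..n. \<bar>autonomous r j y - autonomous r j x\<bar>) \<le> K * sdist n y x"
    by (rule autonomous_lipschitz) blast
  show ?thesis
  \<comment> \<open>The additional 1 pays for the outflow of road 3, whose contribution is a
    difference of states.\<close>
  proof (rule that[of "K + 1"])
    fix T \<phi> fb \<Phi>f3 F \<psi> gb \<Phi>g3 G s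
    assume f: "junction_data T n \<phi> fb \<Phi>f3" "mild T \<phi> fb \<Phi>f3 F"
      and g: "junction_data T n \<psi> gb \<Phi>g3" "mild T \<psi> gb \<Phi>g3 G" and s: "s \<in> {0..T}"
    define b' where "b' r = bdry_limiter n \<Phi> gb \<Phi>g3 G r s" for r
    define b where "b r = bdry_limiter n \<Phi> fb \<Phi>f3 F r s" for r
    define x where "x r = F r s" for r
    define y where "y r = G r s" for r
    define \<delta> where "\<delta> r j = \<bar>boundary b' (\<lambda>r. gb r s) r j y - boundary b (\<lambda>r. fb r s) r j x\<bar>" for r j
    have x: "x \<in> states n" and y: "y \<in> states n"
      using mild_states[OF f(2) s] mild_states[OF g(2) s] by (simp_all add: x_def[abs_def] y_def[abs_def])
    have \<delta>_le: "\<delta> r j \<le> \<bar>b' r - b r\<bar> +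
        (if r = 3 then \<bar>y 3 j - x 3 j\<bar> else \<bar>gb r s j - fb r s j\<bar>)"
      if r: "r \<in> {1..3}" and j: "j \<in> {1..n}" for r j
      unfolding \<delta>_def
    proof (rule boundary_diff_le[OF j])
      show "\<bar>y 3 j\<bar> \<le> 1" using statesD(1,2)[OF y _ j, of 3] by simp
      show "\<bar>b r\<bar> \<le> 1" using bdry_limiter_range[OF f r s] by (simp add: b_def)
      show "\<bar>gb r s j\<bar> \<le> 1" if "r \<noteq> 3"
      proof -
        have "gb r \<in> B_space T n" using g(1) r that unfolding junction_data_def by auto
        from B_spaceD(2)[OF this s j] show ?thesis by simp
      qed
    qed
    have "(\<Sum>r=1..3. \<Sum>j=1..n. \<delta> r j) \<le> (\<Sum>r=1..3. \<Sum>j=1..n. \<bar>b' r - b r\<bar> +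
        (if r = 3 then \<bar>y 3 j - x 3 j\<bar> else \<bar>gb r s j - fb r s j\<bar>))"
      using \<delta>_le by (intro sum_mono) auto
    \<comment> \<open>The limiter gap is the same for every speed class, so summing over the classes
      multiplies it by \<open>n\<close>.\<close>
    also have "\<dots> = n * (\<Sum>r=1..3. \<bar>b' r - b r\<bar>) + (\<Sum>r=1..2. norm1 n (\<lambda>j. gb r s j - fb r s j))
        + norm1 n (\<lambda>j. y 3 j - x 3 j)"
      unfolding sum_1_3 sum_1_2 by (simp add: sum.distrib norm1_def algebra_simps)
    \<comment> \<open>The data term is enlarged by the factor \<open>n \<ge> 1\<close> to make
      \<open>n\<close> a common factor of \<open>data_gap\<close>.\<close>
    also have "\<dots> \<le> n * (\<Sum>r=1..3. \<bar>b' r - b r\<bar>)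
        + n * (\<Sum>r=1..2. norm1 n (\<lambda>j. gb r s j - fb r s j)) + sdist n y x"
    proof (intro add_mono order_refl norm1_le_sdist)
      show "(\<Sum>r=1..2. norm1 n (\<lambda>j. gb r s j - fb r s j))
          \<le> n * (\<Sum>r=1..2. norm1 n (\<lambda>j. gb r s j - fb r s j))"
        using n by (intro mult_right_mono[of 1 "real n", simplified] sum_nonneg norm1_nonneg) auto
    qed simp
    also have "\<dots> = n * data_gap fb \<Phi>f3 F gb \<Phi>g3 G s + sdist n y x"
      by (simp add: data_gap_def b_def b'_def distrib_left)
    finally have 1: "(\<Sum>r=1..3. \<Sum>j=1..n. \<delta> r j)
        \<le> n * data_gap fb \<Phi>f3 F gb \<Phi>g3 G s + sdist n y x" .
    have "(\<Sum>r=1..3. \<Sum>j=1..n. \<bar>source gb \<Phi>g3 G r j s - source fb \<Phi>f3 F r j s\<bar>)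
        \<le> (\<Sum>r=1..3. \<Sum>j=1..n. \<delta> r j + \<bar>autonomous r j y - autonomous r j x\<bar>)"
      unfolding \<delta>_def b_def[abs_def] b'_def[abs_def] x_def[abs_def] y_def[abs_def]
      by (intro sum_mono) linarith
    also have "\<dots> \<le> n * data_gap fb \<Phi>f3 F gb \<Phi>g3 G s + (K + 1) * sdist n y x"
      using 1 K(2)[OF x y] by (simp add: sum.distrib distrib_right)
    finally show "(\<Sum>r=1..3. \<Sum>j=1..n. \<bar>source gb \<Phi>g3 G r j s - source fb \<Phi>f3 F r j s\<bar>)
        \<le> n * data_gap fb \<Phi>f3 F gb \<Phi>g3 G s + (K + 1) * sdist n (\<lambda>r. G r s) (\<lambda>r. F r s)"
      by (simp add: x_def[abs_def] y_def[abs_def])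
  qed (use K in simp)
qed

text \<open>The mild equations are subtracted, absolute values are summed over roads and speed
  classes, and the finite sums are moved under the integral, where \<open>source_diff_le\<close>
  applies pointwise.\<close>

lemma mild_gap_le:
  obtains K where "0 \<le> K" "\<And>T \<phi> fb \<Phi>f3 F \<psi> gb \<Phi>g3 G t.
    junction_data T n \<phi> fb \<Phi>f3 \<Longrightarrow> mild T \<phi> fb \<Phi>f3 F \<Longrightarrow>
    junction_data T n \<psi> gb \<Phi>g3 \<Longrightarrow> mild T \<psi> gb \<Phi>g3 G \<Longrightarrow> t \<in> {0..T} \<Longrightarrow>
    sdist n (\<lambda>r. G r t) (\<lambda>r. F r t) \<le> sdist n \<psi> \<phi>
      + n * integral {0..t} (data_gap fb \<Phi>f3 F gb \<Phi>g3 G)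
      + K * integral {0..t} (\<lambda>s. sdist n (\<lambda>r. G r s) (\<lambda>r. F r s))"
proof -
  obtain K where K: "0 \<le> K" "\<And>T \<phi> fb \<Phi>f3 F \<psi> gb \<Phi>g3 G s.
    junction_data T n \<phi> fb \<Phi>f3 \<Longrightarrow> mild T \<phi> fb \<Phi>f3 F \<Longrightarrow>
    junction_data T n \<psi> gb \<Phi>g3 \<Longrightarrow> mild T \<psi> gb \<Phi>g3 G \<Longrightarrow> s \<in> {0..T} \<Longrightarrow>
    (\<Sum>r=1..3. \<Sum>j=1..n. \<bar>source gb \<Phi>g3 G r j s - source fb \<Phi>f3 F r j s\<bar>)
      \<le> n * data_gap fb \<Phi>f3 F gb \<Phi>g3 G s + K * sdist n (\<lambda>r. G r s) (\<lambda>r. F r s)"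
    by (rule source_diff_le) blast
  show ?thesis
  proof (rule that[OF K(1)])
    fix T \<phi> fb \<Phi>f3 F \<psi> gb \<Phi>g3 G t
    assume f: "junction_data T n \<phi> fb \<Phi>f3" "mild T \<phi> fb \<Phi>f3 F"
      and g: "junction_data T n \<psi> gb \<Phi>g3" "mild T \<psi> gb \<Phi>g3 G" and t: "t \<in> {0..T}"
    let ?D = "data_gap fb \<Phi>f3 F gb \<Phi>g3 G"
    let ?e = "\<lambda>s. sdist n (\<lambda>r. G r s) (\<lambda>r. F r s)"
    let ?M = "lebesgue_on {0..t}"
    let ?S = "\<lambda>r j s. source gb \<Phi>g3 G r j s - source fb \<Phi>f3 F r j s"
    have S: "integrable ?M (?S r j)" if "r \<in> {1..3}" "j \<in> {1..n}" for r j
      by (intro Bochner_Integration.integrable_diff source_integrable[OF f that t]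
          source_integrable[OF g that t])
    have D: "integrable ?M ?D" by (rule data_gap_integrable[OF f g t])
    have "continuous_on {0..T} ?e"
      by (rule continuous_on_sdist) (use mild_B_space[OF f(2)] mild_B_space[OF g(2)] B_spaceD(1) in auto)
    then have "continuous_on {0..t} ?e"
      by (rule continuous_on_subset) (use t in auto)
    then have e: "integrable ?M ?e" by (rule continuous_imp_integrable_real)
    have "\<bar>G r t j - F r t j\<bar> \<le> \<bar>\<psi> r j - \<phi> r j\<bar> + (LINT s|?M. \<bar>?S r j s\<bar>)"
      if "r \<in> {1..3}" "j \<in> {1..n}" for r j
    proof -
      have "(LINT s|?M. ?S r j s)
          = (LINT s|?M. source gb \<Phi>g3 G r j s) - (LINT s|?M. source fb \<Phi>f3 F r j s)"
        by (rule Bochner_Integration.integral_diff[OF source_integrable[OF g that t]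
              source_integrable[OF f that t]])
      then have "G r t j - F r t j = (\<psi> r j - \<phi> r j) + (LINT s|?M. ?S r j s)"
        using mild_eq[OF f(2) t that] mild_eq[OF g(2) t that] by linarith
      moreover have "\<bar>LINT s|?M. ?S r j s\<bar> \<le> (LINT s|?M. \<bar>?S r j s\<bar>)"
        by (rule integral_abs_bound)
      ultimately show ?thesis by linarith
    qed
    then have "?e t \<le> (\<Sum>r=1..3. \<Sum>j=1..n. \<bar>\<psi> r j - \<phi> r j\<bar> + (LINT s|?M. \<bar>?S r j s\<bar>))"
      unfolding sdist_def norm1_def by (intro sum_mono) auto
    also have "\<dots> = sdist n \<psi> \<phi> + (\<Sum>r=1..3. \<Sum>j=1..n. (LINT s|?M. \<bar>?S r j s\<bar>))"
      unfolding sdist_def norm1_def by (simp add: sum.distrib)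
    also have "(\<Sum>r=1..3. \<Sum>j=1..n. (LINT s|?M. \<bar>?S r j s\<bar>))
        = (\<Sum>r=1..3. (LINT s|?M. (\<Sum>j=1..n. \<bar>?S r j s\<bar>)))"
      by (intro sum.cong refl Bochner_Integration.integral_sum[symmetric] integrable_abs S) auto
    also have "\<dots> = (LINT s|?M. (\<Sum>r=1..3. \<Sum>j=1..n. \<bar>?S r j s\<bar>))"
      by (intro Bochner_Integration.integral_sum[symmetric] Bochner_Integration.integrable_sum
          integrable_abs S) auto
    also have "\<dots> \<le> (LINT s|?M. n * ?D s + K * ?e s)"
    proof (rule integral_mono)
      show "integrable ?M (\<lambda>s. \<Sum>r=1..3. \<Sum>j=1..n. \<bar>?S r j s\<bar>)"
        by (intro Bochner_Integration.integrable_sum integrable_abs S) auto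
      show "integrable ?M (\<lambda>s. n * ?D s + K * ?e s)"
        by (intro Bochner_Integration.integrable_add integrable_mult_right D e)
      show "(\<Sum>r=1..3. \<Sum>j=1..n. \<bar>?S r j s\<bar>) \<le> n * ?D s + K * ?e s" if "s \<in> space ?M" for s
        by (rule K(2)[OF f g]) (use that t in simp)
    qed
    also have "\<dots> = (LINT s|?M. n * ?D s) + (LINT s|?M. K * ?e s)"
      by (intro Bochner_Integration.integral_add integrable_mult_right D e)
    \<comment> \<open>For Lebesgue integrable functions the two integrals agree;
      \<open>gronwall\<close> is phrased with the gauge integral.\<close>
    also have "\<dots> = n * integral {0..t} ?D + K * integral {0..t} ?e"
      using lebesgue_integral_eq_integral[OF D] lebesgue_integral_eq_integral[OF e] by simp
    finally show "?e t \<le> sdist n \<psi> \<phi> + n * integral {0..t} ?D + K * integral {0..t} ?e"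
      by simp
  qed
qed

section \<open>Stability estimate and uniqueness\<close>

lemma continuous_dependence:
  assumes "T > 0"
  obtains C where "C > 0" "\<And>\<phi> fb \<Phi>f3 F \<psi> gb \<Phi>g3 G t.
    junction_data T n \<phi> fb \<Phi>f3 \<Longrightarrow> mild T \<phi> fb \<Phi>f3 F \<Longrightarrow>
    junction_data T n \<psi> gb \<Phi>g3 \<Longrightarrow> mild T \<psi> gb \<Phi>g3 G \<Longrightarrow> t \<in> {0..T} \<Longrightarrow>
    sdist n (\<lambda>r. G r t) (\<lambda>r. F r t)
      \<le> C * (sdist n \<psi> \<phi> + (LINT t|lebesgue_on {0..T}. data_gap fb \<Phi>f3 F gb \<Phi>g3 G t))"
proof -
  obtain K where K: "0 \<le> K" "\<And>T \<phi> fb \<Phi>f3 F \<psi> gb \<Phi>g3 G t.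
    junction_data T n \<phi> fb \<Phi>f3 \<Longrightarrow> mild T \<phi> fb \<Phi>f3 F \<Longrightarrow>
    junction_data T n \<psi> gb \<Phi>g3 \<Longrightarrow> mild T \<psi> gb \<Phi>g3 G \<Longrightarrow> t \<in> {0..T} \<Longrightarrow>
    sdist n (\<lambda>r. G r t) (\<lambda>r. F r t) \<le> sdist n \<psi> \<phi>
      + n * integral {0..t} (data_gap fb \<Phi>f3 F gb \<Phi>g3 G)
      + K * integral {0..t} (\<lambda>s. sdist n (\<lambda>r. G r s) (\<lambda>r. F r s))"
    by (rule mild_gap_le) blast
  show ?thesis
  \<comment> \<open>The factor \<open>n\<close> comes from summing the limiter gaps over the speed
    classes, the exponential from Gronwall at the final time.\<close>
  proof (rule that[of "n * exp (K * T)"])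
    show "n * exp (K * T) > 0" using n by simp
    fix \<phi> fb \<Phi>f3 F \<psi> gb \<Phi>g3 G t
    assume f: "junction_data T n \<phi> fb \<Phi>f3" "mild T \<phi> fb \<Phi>f3 F"
      and g: "junction_data T n \<psi> gb \<Phi>g3" "mild T \<psi> gb \<Phi>g3 G" and t: "t \<in> {0..T}"
    let ?D = "data_gap fb \<Phi>f3 F gb \<Phi>g3 G"
    let ?e = "\<lambda>s. sdist n (\<lambda>r. G r s) (\<lambda>r. F r s)"
    let ?I = "LINT t|lebesgue_on {0..T}. ?D t"
    have D: "integrable (lebesgue_on {0..s}) ?D" if "s \<in> {0..T}" for s
      by (rule data_gap_integrable[OF f g that])
    have I: "?I = integral {0..T} ?D"
      using lebesgue_integral_eq_integral[OF D] \<open>T > 0\<close> by simp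
    \<comment> \<open>As the gap is nonnegative, its integral may be extended to the whole horizon,
      giving the time-independent constant that \<open>gronwall\<close> expects.\<close>
    have D_le: "integral {0..s} ?D \<le> ?I" if "s \<in> {0..T}" for s
      unfolding I
    proof (rule integral_subset_le)
      show "?D integrable_on {0..s}" "?D integrable_on {0..T}"
        using D that \<open>T > 0\<close> by (auto intro!: integrable_on_lebesgue_on)
    qed (use that data_gap_nonneg in auto)
    have I_nonneg: "0 \<le> ?I"
      by (intro Bochner_Integration.integral_nonneg data_gap_nonneg)
    have "?e t \<le> (sdist n \<psi> \<phi> + n * ?I) * exp (K * t)"
    proof (rule gronwall[OF _ K(1) _ t])
      show "continuous_on {0..T} ?e"
        by (rule continuous_on_sdist)
          (use mild_B_space[OF f(2)] mild_B_space[OF g(2)] B_spaceD(1) in auto)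
      show "?e s \<le> sdist n \<psi> \<phi> + n * ?I + K * integral {0..s} ?e" if "s \<in> {0..T}" for s
        using K(2)[OF f g that] mult_left_mono[OF D_le[OF that], of "real n"] by simp
    qed
    \<comment> \<open>The initial gap is also enlarged by \<open>n \<ge> 1\<close>, and
      \<open>t\<close> by \<open>T\<close>, to extract a common factor uniform in time.\<close>
    also have "\<dots> \<le> (n * sdist n \<psi> \<phi> + n * ?I) * exp (K * T)"
    proof (rule mult_mono)
      show "sdist n \<psi> \<phi> + n * ?I \<le> n * sdist n \<psi> \<phi> + n * ?I"
        using n mult_right_mono[of 1 "real n" "sdist n \<psi> \<phi>"] sdist_nonneg[of n \<psi> \<phi>] by simp
      show "0 \<le> n * sdist n \<psi> \<phi> + n * ?I"
        by (intro add_nonneg_nonneg mult_nonneg_nonneg sdist_nonneg I_nonneg) auto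
    qed (use K(1) t in \<open>auto intro: mult_left_mono\<close>)
    finally show "?e t \<le> n * exp (K * T) * (sdist n \<psi> \<phi> + ?I)"
      by (simp add: algebra_simps)
  qed
qed

text \<open>The boundary limiters of roads 1 and 2 depend on the solution, so equal data do not by
    themselves make \<open>data_gap\<close> vanish; it is only controlled by the distance of the solutions.\<close>
lemma data_gap_same_data_le:
  obtains l where "0 \<le> l" "\<And>T \<phi> fb \<Phi>3 F G s.
    junction_data T n \<phi> fb \<Phi>3 \<Longrightarrow> mild T \<phi> fb \<Phi>3 F \<Longrightarrow> mild T \<phi> fb \<Phi>3 G \<Longrightarrow> s \<in> {0..T} \<Longrightarrow>
    data_gap fb \<Phi>3 F fb \<Phi>3 G s \<le> l * sdist n (\<lambda>r. G r s) (\<lambda>r. F r s)"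
proof -
  obtain l where l: "l > 0"
    "\<And>a b c d. a \<in> {0..1} \<Longrightarrow> b \<in> {0..1} \<Longrightarrow> c \<in> {0..1} \<Longrightarrow> d \<in> {0..1} \<Longrightarrow>
      \<bar>\<Phi> a b - \<Phi> c d\<bar> \<le> l * (\<bar>a - c\<bar> + \<bar>b - d\<bar>)"
    by (rule \<Phi>_lipschitz) blast
  show ?thesis
  \<comment> \<open>One \<open>l\<close> for each of roads 1 and 2; the limiter of road 3 is
    prescribed and cancels, as do the inflow data.\<close>
  proof (rule that[of "2 * l"])
    fix T \<phi> fb \<Phi>3 F G s
    assume d: "junction_data T n \<phi> fb \<Phi>3" and F: "mild T \<phi> fb \<Phi>3 F" and G: "mild T \<phi> fb \<Phi>3 G"
      and s: "s \<in> {0..T}"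
    let ?x = "\<lambda>r. F r s" and ?y = "\<lambda>r. G r s"
    have "\<bar>bdry_limiter n \<Phi> fb \<Phi>3 G r s - bdry_limiter n \<Phi> fb \<Phi>3 F r s\<bar> \<le> l * sdist n ?y ?x"
      if r: "r \<in> {1..2}" for r
    proof -
      have fb: "fb r \<in> B_space T n" using d r unfolding junction_data_def by blast
      have r3: "r \<in> {1..3}" using r by simp
      have "\<bar>bdry_limiter n \<Phi> fb \<Phi>3 G r s - bdry_limiter n \<Phi> fb \<Phi>3 F r s\<bar>
          \<le> l * (\<bar>car_density n (fb r s) - car_density n (fb r s)\<bar>
              + \<bar>car_density n (G r s) - car_density n (F r s)\<bar>)"
        using B_spaceD(5)[OF fb] s r statesD(3)[OF mild_states[OF F s] r3]
          statesD(3)[OF mild_states[OF G s] r3] l(2)[of "car_density n (fb r s)"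
            "car_density n (G r s)" "car_density n (fb r s)" "car_density n (F r s)"]
        by (simp add: bdry_limiter_def image_subset_iff)
      also have "\<dots> \<le> l * sdist n ?y ?x"
        using density_le_sdist[OF r3, of n ?y ?x] l(1) by (intro mult_left_mono) auto
      finally show ?thesis .
    qed
    from this[of 1] this[of 2] show "data_gap fb \<Phi>3 F fb \<Phi>3 G s \<le> 2 * l * sdist n ?y ?x"
      unfolding data_gap_def sum_1_3 by (simp add: norm1_def bdry_limiter_def)
  qed (use l in simp)
qed

text \<open>The integral inequality is used before Gronwall is applied: the data gap is replaced by
  a multiple of the distance, which leaves a homogeneous inequality.\<close>

lemma mild_solution_unique:
  assumes d: "junction_data T n \<phi> fb \<Phi>3" and F: "mild T \<phi> fb \<Phi>3 F" and G: "mild T \<phi> fb \<Phi>3 G"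
    and t: "t \<in> {0..T}" and r: "r \<in> {1..3}" and j: "j \<in> {1..n}"
  shows "F r t j = G r t j"
proof -
  let ?D = "data_gap fb \<Phi>3 F fb \<Phi>3 G"
  let ?e = "\<lambda>s. sdist n (\<lambda>r. G r s) (\<lambda>r. F r s)"
  obtain l where l: "0 \<le> l" "\<And>s. s \<in> {0..T} \<Longrightarrow> ?D s \<le> l * ?e s"
    by (rule data_gap_same_data_le) (use d F G in blast)
  obtain K where K: "0 \<le> K" "\<And>t. t \<in> {0..T} \<Longrightarrow>
      ?e t \<le> sdist n \<phi> \<phi> + n * integral {0..t} ?D + K * integral {0..t} ?e"
    by (rule mild_gap_le) (use d F G in blast)
  have e: "continuous_on {0..T} ?e"
    by (rule continuous_on_sdist) (use mild_B_space[OF F] mild_B_space[OF G] B_spaceD(1) in auto)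
  \<comment> \<open>The initial data coincide, so the constant is \<open>0\<close>; the rate
    combines \<open>n * l\<close> from the absorbed data gap with \<open>K\<close> from the
    sources.\<close>
  have "?e t \<le> 0 * exp ((n * l + K) * t)"
  proof (rule gronwall[OF e _ _ t])
    show "0 \<le> n * l + K" using l(1) K(1) by simp
    fix s assume s: "s \<in> {0..T}"
    have "integral {0..s} ?D \<le> integral {0..s} (\<lambda>s. l * ?e s)"
    proof (rule integral_le)
      show "?D integrable_on {0..s}"
        by (intro integrable_on_lebesgue_on data_gap_integrable[OF d F d G s]) simp
      show "(\<lambda>s. l * ?e s) integrable_on {0..s}"
        by (intro integrable_continuous_real continuous_on_mult_left continuous_on_subset[OF e])
          (use s in auto)
    qed (use l(2) s in auto)
    then have "n * integral {0..s} ?D \<le> n * l * integral {0..s} ?e"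
      using mult_left_mono[of _ _ "real n"] by (fastforce simp: mult.assoc)
    moreover have "sdist n \<phi> \<phi> = 0" by (simp add: sdist_def norm1_def)
    ultimately show "?e s \<le> 0 + (n * l + K) * integral {0..s} ?e"
      using K(2)[OF s] by (simp add: distrib_right)
  qed
  then show ?thesis
    using component_le_sdist[OF r j, of "\<lambda>r. G r t" "\<lambda>r. F r t"] by simp
qed

end

theorem theorem4p8:
  fixes T p \<eta> \<epsilon> :: real and n :: nat and v :: "nat \<Rightarrow> real" and H :: "real \<Rightarrow> real"
    and A :: "nat \<Rightarrow> nat \<Rightarrow> nat \<Rightarrow> real \<Rightarrow> real" and \<Phi> :: "real \<Rightarrow> real \<Rightarrow> real"
  assumes "T > 0" and "n \<ge> 2"
    and "v 1 = 0" and "strict_mono_on {1..n} v" and "v n = 1"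
    and "0 \<le> p" and "p \<le> 1" and "p \<le> v 2"
    and "\<eta> > 0" and "\<epsilon> > 0" and "regularized_step \<epsilon> H"
    and "table_of_games n A" and "flux_limiter \<Phi>"
  shows "(\<exists>C>0. \<forall>\<phi> fb \<Phi>f3 F \<psi> gb \<Phi>g3 G.
            junction_data T n \<phi> fb \<Phi>f3 \<and> mild_solution T n v p H \<eta> A \<Phi> \<phi> fb \<Phi>f3 F \<and>
            junction_data T n \<psi> gb \<Phi>g3 \<and> mild_solution T n v p H \<eta> A \<Phi> \<psi> gb \<Phi>g3 G \<longrightarrow>
            norm_sup T n (\<lambda>r t j. G r t j - F r t j)
              \<le> C * ((\<Sum>r=1..3. norm1 n (\<lambda>j. \<psi> r j - \<phi> r j)) +
                   (LINT t|lebesgue_on {0..T}.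
                      (\<Sum>r=1..3. \<bar>bdry_limiter n \<Phi> gb \<Phi>g3 G r t - bdry_limiter n \<Phi> fb \<Phi>f3 F r t\<bar>) +
                      (\<Sum>r=1..2. norm1 n (\<lambda>j. gb r t j - fb r t j))))) \<and>
         (\<forall>\<phi> fb \<Phi>3 F G.
            junction_data T n \<phi> fb \<Phi>3 \<and>
            mild_solution T n v p H \<eta> A \<Phi> \<phi> fb \<Phi>3 F \<and> mild_solution T n v p H \<eta> A \<Phi> \<phi> fb \<Phi>3 G \<longrightarrow>
            (\<forall>r\<in>{1..3}. \<forall>t\<in>{0..T}. \<forall>j\<in>{1..n}. F r t j = G r t j))"
proof -
  interpret junction n v p \<eta> \<epsilon> H A \<Phi>
    by (rule junction.intro) (fact assms)+
  \<comment> \<open>\<open>C\<close> is fixed before data and solutions are chosen, so one constant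
    serves all pairs.\<close>
  obtain C where C: "C > 0" "\<And>\<phi> fb \<Phi>f3 F \<psi> gb \<Phi>g3 G t.
    junction_data T n \<phi> fb \<Phi>f3 \<Longrightarrow> mild T \<phi> fb \<Phi>f3 F \<Longrightarrow>
    junction_data T n \<psi> gb \<Phi>g3 \<Longrightarrow> mild T \<psi> gb \<Phi>g3 G \<Longrightarrow> t \<in> {0..T} \<Longrightarrow>
    sdist n (\<lambda>r. G r t) (\<lambda>r. F r t)
      \<le> C * (sdist n \<psi> \<phi> + (LINT t|lebesgue_on {0..T}. data_gap fb \<Phi>f3 F gb \<Phi>g3 G t))"
    using \<open>T > 0\<close> by (rule continuous_dependence) blast
  show ?thesis
  proof (intro conjI exI[of _ C] allI impI ballI)
    fix \<phi> fb \<Phi>f3 F \<psi> gb \<Phi>g3 G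
    assume "junction_data T n \<phi> fb \<Phi>f3 \<and> mild T \<phi> fb \<Phi>f3 F \<and>
      junction_data T n \<psi> gb \<Phi>g3 \<and> mild T \<psi> gb \<Phi>g3 G"
    then have le: "sdist n (\<lambda>r. G r t) (\<lambda>r. F r t)
        \<le> C * (sdist n \<psi> \<phi> + (LINT t|lebesgue_on {0..T}. data_gap fb \<Phi>f3 F gb \<Phi>g3 G t))"
      if "t \<in> {0..T}" for t
      using C(2) that by blast
    \<comment> \<open>The bound is uniform in \<open>t\<close> and \<open>{0..T}\<close> is
      nonempty, so it passes to the supremum.\<close>
    have "norm_sup T n (\<lambda>r t j. G r t j - F r t j)
        \<le> C * (sdist n \<psi> \<phi> + (LINT t|lebesgue_on {0..T}. data_gap fb \<Phi>f3 F gb \<Phi>g3 G t))"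
      unfolding norm_sup_def
      by (rule cSUP_least) (use \<open>T > 0\<close> le in \<open>auto simp: sdist_def norm1_def\<close>)
    then show "norm_sup T n (\<lambda>r t j. G r t j - F r t j)
        \<le> C * ((\<Sum>r=1..3. norm1 n (\<lambda>j. \<psi> r j - \<phi> r j)) +
           (LINT t|lebesgue_on {0..T}.
              (\<Sum>r=1..3. \<bar>bdry_limiter n \<Phi> gb \<Phi>g3 G r t - bdry_limiter n \<Phi> fb \<Phi>f3 F r t\<bar>) +
              (\<Sum>r=1..2. norm1 n (\<lambda>j. gb r t j - fb r t j))))"
      unfolding sdist_def data_gap_def .
  next
    show "0 < C" by (rule C(1))
  next
    fix \<phi> fb \<Phi>3 F G and r :: nat and t :: real and j :: nat
    assume "junction_data T n \<phi> fb \<Phi>3 \<and> mild T \<phi> fb \<Phi>3 F \<and> mild T \<phi> fb \<Phi>3 G"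
      and "r \<in> {1..3}" "t \<in> {0..T}" "j \<in> {1..n}"
    then show "F r t j = G r t j" by (elim conjE) (rule mild_solution_unique)
  qed
qed

end
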